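(* Let $d\geq 2$ be an integer and let $S$ be a $d$-symmetric numerical semigroup. If $x$ is the smallest element of $S$ such that $x\equiv f(S) \pmod d$, then $$f\left(\frac{S}{d}\right)=\frac{f(S)-x}{d}.$$
   Context: $\mathbb{N}$ denotes the set of nonnegative integers. A numerical semigroup is a submonoid $S$ of $(\mathbb{N},+)$ (so $0\in S$) such that $\mathbb{N}\setminus S$ is finite. The Frobenius number $f(S)$ is the largest integer not belonging to $S$ (so $f(\mathbb{N})=-1$). The quotient of $S$ by a positive integer $d$ is the numerical semigroup $\frac{S}{d}=\{s\in\mathbb{N}\mid ds\in S\}$. A numerical semigroup $S$ is $d$-symmetric if for all integers $n\in\mathbb{Z}$, whenever $d$ divides $n$, either $n$ or $f(S)-n$ is in $S$. *)

theory Defs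
  imports Complex_Main "HOL-Number_Theory.Cong"
begin

definition numerical_semigroup :: "nat set \<Rightarrow> bool" where
  "numerical_semigroup S \<longleftrightarrow>
     0 \<in> S \<and> (\<forall>a\<in>S. \<forall>b\<in>S. a + b \<in> S) \<and> finite (UNIV - S)"

(* The maximum ranges over all integers, not only over the gaps of S in the naturals:
   negative integers never lie in S, which gives the value -1 for S = UNIV. *)
definition frobenius_number :: "nat set \<Rightarrow> int" where
  "frobenius_number S = (GREATEST k. k \<notin> int ` S)"

definition semigroup_quotient :: "nat set \<Rightarrow> nat \<Rightarrow> nat set" where
  "semigroup_quotient S d = {s. d * s \<in> S}"

definition d_symmetric :: "nat \<Rightarrow> nat set \<Rightarrow> bool" where
  "d_symmetric d S \<longleftrightarrow>
     (\<forall>n::int. int d dvd n \<longrightarrow> n \<in> int ` S \<or> frobenius_number S - n \<in> int ` S)"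

lemma frobenius_number_UNIV: "frobenius_number UNIV = -1"
  unfolding frobenius_number_def
proof (rule Greatest_equality)
  show "- 1 \<notin> range int" by auto
next
  fix y :: int
  assume "y \<notin> range int"
  then show "y \<le> - 1" by (metis linorder_not_less rangeI zero_le_imp_eq_int zless_imp_add1_zle
        add.left_inverse)
qed

lemma numerical_semigroup_quotient:
  assumes "numerical_semigroup S" and "d > 0"
  shows "numerical_semigroup (semigroup_quotient S d)"
proof -
  have "finite ((\<lambda>s. d * s) -` (UNIV - S))"
    using assms by (intro finite_vimageI) (auto simp: numerical_semigroup_def inj_def)
  moreover have "(\<lambda>s. d * s) -` (UNIV - S) = UNIV - semigroup_quotient S d"
    by (auto simp: semigroup_quotient_def)
  ultimately show ?thesis
    using assms by (auto simp: numerical_semigroup_def semigroup_quotient_def distrib_left)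
qed

end

theory Submission
  imports Defs
begin

text \<open>
  Put \<open>f = f(S)\<close> and \<open>f - x = d k\<close>. The integer \<open>k\<close> is not in \<open>S/d\<close>, since \<open>d k \<in> S\<close> would
  give \<open>f = x + d k \<in> S\<close>. Every integer \<open>m > k\<close> is in \<open>S/d\<close>: otherwise
  \<open>d\<close>-symmetry, applied to the multiple \<open>d m\<close> of \<open>d\<close>, puts \<open>f - d m\<close> in \<open>S\<close>; this is an
  element of \<open>S\<close> in the residue class of \<open>f\<close> and smaller than \<open>f - d k = x\<close>, against the
  minimality of \<open>x\<close>. So \<open>k\<close> is the largest integer outside \<open>S/d\<close>. The argument runs over
  the integers throughout, because \<open>k\<close> is negative when \<open>S/d\<close> is all of the naturals.
\<close>

text \<open>
  The operator \<open>GREATEST\<close> says nothing unless a maximum exists. Here it does, because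
  only finitely many integers from \<open>-1\<close> on lie outside \<open>S\<close>, and \<open>-1\<close> is one of them.
\<close>

lemma frobenius_number_notin:
  assumes "numerical_semigroup S"
  shows "frobenius_number S \<notin> int ` S"
proof -
  define G where "G = insert (-1) (int ` (UNIV - S))"
  have fin: "finite G"
    using assms by (simp add: G_def numerical_semigroup_def)
  have "frobenius_number S = Max G"
    unfolding frobenius_number_def
  proof (rule Greatest_equality)
    have "Max G \<in> G"
      using fin by (intro Max_in) (auto simp: G_def)
    then show "Max G \<notin> int ` S"
      by (auto simp: G_def)
  next
    fix y :: int
    assume y: "y \<notin> int ` S"
    show "y \<le> Max G"
    proof (cases "y \<ge> 0")
      case True
      with y have "y \<in> G"
        by (auto simp: G_def image_iff elim!: nonneg_int_cases)
      then show ?thesis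
        using fin by simp
    next
      case False
      moreover have "-1 \<le> Max G"
        using fin by (simp add: G_def)
      ultimately show ?thesis
        by simp
    qed
  qed
  moreover have "Max G \<in> G"
    using fin by (intro Max_in) (auto simp: G_def)
  ultimately show ?thesis
    by (auto simp: G_def)
qed

lemma mem_int_semigroup_quotient_iff:
  assumes "d > 0"
  shows "m \<in> int ` semigroup_quotient S d \<longleftrightarrow> int d * m \<in> int ` S"
proof
  assume "m \<in> int ` semigroup_quotient S d"
  then show "int d * m \<in> int ` S"
    by (auto simp: semigroup_quotient_def simp flip: of_nat_mult)
next
  assume "int d * m \<in> int ` S"
  then obtain s where s: "s \<in> S" "int d * m = int s"
    by auto
  then have "0 \<le> int d * m"
    by simp
  with assms have "m \<ge> 0"
    by (simp add: zero_le_mult_iff)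
  then obtain n where n: "m = int n"
    by (rule nonneg_int_cases)
  with s have "s = d * n"
    by (metis of_nat_eq_iff of_nat_mult)
  with s n show "m \<in> int ` semigroup_quotient S d"
    by (auto simp: semigroup_quotient_def)
qed

theorem theorem4p2:
  fixes d :: nat and S :: "nat set" and x :: nat
  assumes "d \<ge> 2"
    and "numerical_semigroup S"
    and "d_symmetric d S"
    and "x \<in> S"
    and "[int x = frobenius_number S] (mod int d)"
    and "\<And>y. y \<in> S \<Longrightarrow> [int y = frobenius_number S] (mod int d) \<Longrightarrow> x \<le> y"
  shows "real_of_int (frobenius_number (semigroup_quotient S d))
           = (real_of_int (frobenius_number S) - real x) / real d"
proof -
  define f where "f = frobenius_number S"
  have d: "d > 0"
    using assms(1) by simp
  have "int d dvd f - int x"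
    using assms(5) by (metis f_def cong_iff_dvd_diff cong_sym)
  then obtain k where k: "f - int x = int d * k"
    by (rule dvdE)
  have "frobenius_number (semigroup_quotient S d) = k"
    unfolding frobenius_number_def
  proof (rule Greatest_equality)
    show "k \<notin> int ` semigroup_quotient S d"
    proof
      assume "k \<in> int ` semigroup_quotient S d"
      then obtain s where s: "s \<in> S" "int d * k = int s"
        unfolding mem_int_semigroup_quotient_iff[OF d] by auto
      have "x + s \<in> S"
        using assms(2,4) s(1) by (simp add: numerical_semigroup_def)
      moreover have "f = int (x + s)"
        using k s(2) by simp
      ultimately show False
        using frobenius_number_notin[OF assms(2)] by (metis f_def imageI)
    qed
  next
    fix m
    assume "m \<notin> int ` semigroup_quotient S d"
    then have "int d * m \<notin> int ` S"
      by (simp add: mem_int_semigroup_quotient_iff[OF d])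
    then have "f - int d * m \<in> int ` S"
      using assms(3) unfolding d_symmetric_def f_def by (metis dvd_triv_left)
    then obtain y where y: "y \<in> S" "int y = f - int d * m"
      by auto
    have "[int y = f] (mod int d)"
      by (simp add: y(2) cong_iff_dvd_diff)
    then have "x \<le> y"
      using assms(6) y(1) by (simp add: f_def)
    then have "int d * m \<le> int d * k"
      using k y(2) by linarith
    then show "m \<le> k"
      using d by simp
  qed
  moreover have "real_of_int f - real x = real d * real_of_int k"
    using arg_cong[OF k, of real_of_int] by simp
  ultimately show ?thesis
    using d by (simp add: f_def)
qed

end
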